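(* Let $S_1$ and $S_2$ be numerical semigroups minimally generated by $m_1<\cdots<m_d$ and $n_1<\cdots<n_k$ respectively, and let $S=\langle qm_1,\ldots,qm_d,pn_1,\ldots,pn_k\rangle$ be a specific gluing of $S_1$ and $S_2$. If $S_1$ has non-decreasing Hilbert function, then $G(S)$ has non-decreasing Hilbert function.
   Context: A numerical semigroup $T$ is a submonoid of $(\mathbb{Z}_{\ge 0},+)$ with finite complement; $\langle\cdots\rangle$ denotes the semigroup (with $0$) generated by the listed integers. Let $M=T\setminus\{0\}$, $nM=M+\cdots+M$ ($n$ summands), $0M=T$. For $s\in T$, $\mathrm{ord}_T(s)$ is the maximum $n\ge 0$ with $s\in nM$. Fix a field $K$; $R=K[[T]]=K[[t^s : s\in T]]$ is the numerical semigroup ring, with maximal ideal $\mathfrak m=(t^s: s\in M)$, and $G(T)=\bigoplus_{n\ge 0}\mathfrak m^n/\mathfrak m^{n+1}$ is its tangent cone. The Hilbert function of $T$ (equivalently of $K[[T]]$, or of $G(T)$) is $H(n)=\lambda(\mathfrak m^n/\mathfrak m^{n+1})=\#(nM\setminus (n+1)M)$ for $n\ge 0$, where $\lambda$ is length; it is non-decreasing if $H(n)\le H(n+1)$ for all $n\ge 0$. Let $e=\min M$ be the multiplicity of $T$ and let $r=\min\{r\ge 0 : (r+1)M=e+rM\}$ be the reduction number of $T$. For $x\in T$ put $l_x(T)=\max\{\mathrm{ord}_T(s+x)-\mathrm{ord}_T(x)-\mathrm{ord}_T(s) : s\in T,\ \mathrm{ord}_T(s)\le r\}$. Gluing: given positive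 integers $p\in S_1\setminus\{m_1,\ldots,m_d\}$ and $q\in S_2\setminus\{n_1,\ldots,n_k\}$ with $\gcd(p,q)=1$, the numerical semigroup $S=\langle qm_1,\ldots,qm_d,pn_1,\ldots,pn_k\rangle$ is called a gluing of $S_1$ and $S_2$. It is a specific gluing of $S_1$ and $S_2$ if $\mathrm{ord}_{S_2}(q)+l_q(S_2)\le \mathrm{ord}_{S_1}(p)$. *)

theory Defs
  imports
    "HOL-Algebra.Module"
    "HOL-Algebra.QuotRing"
    "HOL-Algebra.Ideal_Product"
    "HOL-Library.Extended_Nat"
    "HOL-Computational_Algebra.Formal_Power_Series"
begin

section \<open>Numerical semigroups\<close>

definition numerical_semigroup :: "nat set \<Rightarrow> bool" where
  "numerical_semigroup T \<longleftrightarrow>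
     0 \<in> T \<and> (\<forall>a\<in>T. \<forall>b\<in>T. a + b \<in> T) \<and> finite (- T)"

inductive_set generated_semigroup :: "nat set \<Rightarrow> nat set" for A :: "nat set" where
  zero: "0 \<in> generated_semigroup A"
| add: "a \<in> A \<Longrightarrow> s \<in> generated_semigroup A \<Longrightarrow> a + s \<in> generated_semigroup A"

definition minimally_generates :: "nat set \<Rightarrow> nat set \<Rightarrow> bool" where
  "minimally_generates A T \<longleftrightarrow>
     generated_semigroup A = T \<and> (\<forall>B. B \<subset> A \<longrightarrow> generated_semigroup B \<noteq> T)"

definition max_part :: "nat set \<Rightarrow> nat set" where
  "max_part T = T - {0}"

text \<open>The \<open>n\<close>-fold sumset \<open>nM\<close>, with the convention \<open>0M = T\<close>.\<close>

definition nfold_max_part :: "nat \<Rightarrow> nat set \<Rightarrow> nat set" where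
  "nfold_max_part n T =
     (if n = 0 then T else {\<Sum>i<n. f i | f. \<forall>i<n. f i \<in> max_part T})"

text \<open>For \<open>s \<in> T\<close> the set below is nonempty and bounded by \<open>s\<close>.\<close>

definition ord_sg :: "nat set \<Rightarrow> nat \<Rightarrow> nat" where
  "ord_sg T s = Max {n. s \<in> nfold_max_part n T}"

definition multiplicity_sg :: "nat set \<Rightarrow> nat" where
  "multiplicity_sg T = (LEAST e. e \<in> max_part T)"

definition reduction_number :: "nat set \<Rightarrow> nat" where
  "reduction_number T =
     (LEAST r. nfold_max_part (r + 1) T = (\<lambda>s. multiplicity_sg T + s) ` nfold_max_part r T)"

definition l_sg :: "nat \<Rightarrow> nat set \<Rightarrow> int" where
  "l_sg x T = Max {int (ord_sg T (s + x)) - int (ord_sg T x) - int (ord_sg T s) | s.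
                     s \<in> T \<and> ord_sg T s \<le> reduction_number T}"


section \<open>Gluings\<close>

text \<open>\<open>A\<close> and \<open>B\<close> are the sets of minimal generators of \<open>S\<^sub>1\<close> and \<open>S\<^sub>2\<close>.\<close>

definition is_gluing ::
    "nat set \<Rightarrow> nat set \<Rightarrow> nat set \<Rightarrow> nat set \<Rightarrow> nat \<Rightarrow> nat \<Rightarrow> nat set \<Rightarrow> bool" where
  "is_gluing S\<^sub>1 A S\<^sub>2 B p q S \<longleftrightarrow>
     0 < p \<and> 0 < q \<and> p \<in> S\<^sub>1 - A \<and> q \<in> S\<^sub>2 - B \<and> gcd p q = 1 \<and>
     S = generated_semigroup ((\<lambda>a. q * a) ` A \<union> (\<lambda>b. p * b) ` B)"

definition is_specific_gluing ::
    "nat set \<Rightarrow> nat set \<Rightarrow> nat set \<Rightarrow> nat set \<Rightarrow> nat \<Rightarrow> nat \<Rightarrow> nat set \<Rightarrow> bool" where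
  "is_specific_gluing S\<^sub>1 A S\<^sub>2 B p q S \<longleftrightarrow>
     is_gluing S\<^sub>1 A S\<^sub>2 B p q S \<and> int (ord_sg S\<^sub>2 q) + l_sg q S\<^sub>2 \<le> int (ord_sg S\<^sub>1 p)"


section \<open>Quotients of ideals and length of modules\<close>

text \<open>
  The \<open>R\<close>-module \<open>I/J\<close> for ideals \<open>J \<subseteq> I\<close> of \<open>R\<close>. The record type of modules
  extends that of rings, so the multiplicative fields, which play no role in a module, are left
  unspecified.
\<close>

definition quot_module :: "('a, 'c) ring_scheme \<Rightarrow> 'a set \<Rightarrow> 'a set \<Rightarrow> ('a, 'a set) module" where
  "quot_module R I J =
     \<lparr>carrier = {J +>\<^bsub>R\<^esub> x | x. x \<in> I}, monoid.mult = undefined, one = undefined,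
      zero = J, add = set_add R,
      smult = (\<lambda>r X. \<Union>x\<in>X. J +>\<^bsub>R\<^esub> (r \<otimes>\<^bsub>R\<^esub> x))\<rparr>"

definition module_length :: "('a, 'c) ring_scheme \<Rightarrow> ('a, 'b, 'd) module_scheme \<Rightarrow> enat" where
  "module_length R M =
     (SUP l \<in> {l. \<exists>N. (\<forall>i\<le>l. submodule (N i) R M) \<and> (\<forall>i<l. N i \<subset> N (Suc i))}. enat l)"


section \<open>Numerical semigroup rings, tangent cones and Hilbert functions\<close>

text \<open>The ring \<open>K[[T]]\<close>: the power series whose support lies in \<open>T\<close>.\<close>

definition semigroup_ring :: "nat set \<Rightarrow> 'k::field fps ring" where
  "semigroup_ring T =
     \<lparr>carrier = {f. \<forall>n. fps_nth f n \<noteq> 0 \<longrightarrow> n \<in> T}, monoid.mult = (*), one = 1, zero = 0, add = (+)\<rparr>"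

definition max_ideal :: "nat set \<Rightarrow> 'k::field fps set" where
  "max_ideal T = Idl\<^bsub>semigroup_ring T\<^esub> {fps_X ^ s | s. s \<in> max_part T}"

definition max_ideal_power :: "nat set \<Rightarrow> nat \<Rightarrow> 'k::field fps set" where
  "max_ideal_power T n = max_ideal T [^]\<^bsub>ideals_set (semigroup_ring T)\<^esub> n"

text \<open>The homogeneous component of degree \<open>n\<close> of the tangent cone \<open>G(T)\<close>.\<close>

definition tangent_cone_component :: "nat set \<Rightarrow> nat \<Rightarrow> ('k::field fps, 'k fps set) module" where
  "tangent_cone_component T n =
     quot_module (semigroup_ring T) (max_ideal_power T n) (max_ideal_power T (Suc n))"

text \<open>The argument \<open>K\<close> only fixes the coefficient field.\<close>

definition hilbert_function :: "'k::field itself \<Rightarrow> nat set \<Rightarrow> nat \<Rightarrow> enat" where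
  "hilbert_function K T n =
     module_length (semigroup_ring T :: 'k fps ring) (tangent_cone_component T n)"

definition nondecreasing_hilbert_function :: "'k::field itself \<Rightarrow> nat set \<Rightarrow> bool" where
  "nondecreasing_hilbert_function K T \<longleftrightarrow>
     (\<forall>n. hilbert_function K T n \<le> hilbert_function K T (Suc n))"

end

theory Submission
  imports Defs
begin

text \<open>
  Write \<open>H\<^sub>T(n)\<close> for the number of elements of order \<open>n\<close> in a semigroup \<open>T\<close>, and let \<open>Ap\<close> be the
  Apery set of \<open>S\<^sub>2\<close> with respect to \<open>q\<close>, that is, the elements \<open>b\<close> of \<open>S\<^sub>2\<close> such that \<open>b - q\<close> is not
  in \<open>S\<^sub>2\<close>. The theorem follows from the identity
  \<open>H\<^sub>S(n) = (\<Sum>b \<in> Ap, ord b \<le> n. H\<^sub>S\<^sub>1(n - ord b))\<close>,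
  whose right-hand side is monotone in \<open>n\<close> as soon as the Hilbert function of \<open>S\<^sub>1\<close> is: each summand
  grows, and raising \<open>n\<close> can only add summands.

  The identity comes from a normal form. As \<open>p\<close> and \<open>q\<close> are coprime, two ways to write an element
  of \<open>S\<close> as \<open>q a + p b\<close> with \<open>a\<close> in \<open>S\<^sub>1\<close> and \<open>b\<close> in \<open>S\<^sub>2\<close> differ by trading \<open>p j\<close> in the first
  component against \<open>q j\<close> in the second. Hence there is exactly one way with \<open>b\<close> in \<open>Ap\<close>, and it is
  the one with the largest \<open>a\<close>. The order of an element of \<open>S\<close> is the maximum of \<open>ord a + ord b\<close>
  over all its representations. Moving \<open>p j\<close> into the first component raises the order there by at
  least \<open>j ord p\<close>, and it lowers the order in the second component by at most
  \<open>j (ord q + l\<^sub>q)\<close>. For a specific gluing the second amount is at most the first, so the maximum is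
  attained at the normal form, and \<open>ord (q a + p b) = ord a + ord b\<close> for \<open>b\<close> in \<open>Ap\<close>
  (lemma \<open>ord_glued\<close>).

  The constant \<open>l\<^sub>q\<close> only looks at elements of order at most the reduction number. From that order on,
  adding the multiplicity raises the order by exactly one, so the bound given by \<open>l\<^sub>q\<close> propagates to
  all elements (lemma \<open>ord_add_le\<close>).

  Finally, the Hilbert function is given as a length of modules. For a finitely generated semigroup
  \<open>T\<close> the power \<open>\<mm>\<^sup>n\<close> of the maximal ideal consists of all series with support in \<open>nM\<close>, and the
  length of a quotient of two such monomial ideals is the number of exponents by which they differ
  (lemmas \<open>max_ideal_power_eq\<close> and \<open>module_length_quotient\<close>). Submodules of the quotient are compared
  through the exponents of leading terms, as in Gaussian elimination.
\<close>

section \<open>Sumsets and orders in submonoids of the natural numbers\<close>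

text \<open>
The results on sumsets and orders that hold for every submonoid of the natural numbers are kept apart
from those that use generators or a finite complement. In this way they apply to a gluing from
its additive structure alone.
\<close>

locale nat_submonoid =
  fixes T :: "nat set"
  assumes zero_in: "0 \<in> T" and add_in: "a \<in> T \<Longrightarrow> b \<in> T \<Longrightarrow> a + b \<in> T"
begin

lemma nfold_0 [simp]: "nfold_max_part 0 T = T"
  by (simp add: nfold_max_part_def)

lemma nfold_Suc: "nfold_max_part (Suc n) T = {x + y | x y. x \<in> max_part T \<and> y \<in> nfold_max_part n T}"
proof (cases n)
  case 0
  show ?thesis
  proof (intro equalityI subsetI)
    fix s assume "s \<in> nfold_max_part (Suc n) T"
    then have "s \<in> max_part T" using 0 by (auto simp: nfold_max_part_def)
    then have "s = s + 0 \<and> s \<in> max_part T \<and> 0 \<in> nfold_max_part n T" using 0 zero_in by simp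
    then show "s \<in> {x + y | x y. x \<in> max_part T \<and> y \<in> nfold_max_part n T}" by blast
  next
    fix s assume "s \<in> {x + y | x y. x \<in> max_part T \<and> y \<in> nfold_max_part n T}"
    then have "s \<in> max_part T" using 0 add_in by (auto simp: max_part_def)
    then show "s \<in> nfold_max_part (Suc n) T"
      using 0 by (auto simp: nfold_max_part_def intro!: exI[of _ "\<lambda>_. s"])
  qed
next
  case (Suc k)
  show ?thesis
  proof (intro equalityI subsetI)
    fix s assume "s \<in> nfold_max_part (Suc n) T"
    then obtain f where f: "s = (\<Sum>i<Suc n. f i)" "\<forall>i<Suc n. f i \<in> max_part T"
      by (auto simp: nfold_max_part_def)
    then have "s = f n + (\<Sum>i<n. f i)" by simp
    moreover have "(\<Sum>i<n. f i) \<in> nfold_max_part n T"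
      using f(2) Suc by (auto simp: nfold_max_part_def)
    moreover have "f n \<in> max_part T" using f(2) by simp
    ultimately show "s \<in> {x + y | x y. x \<in> max_part T \<and> y \<in> nfold_max_part n T}" by blast
  next
    fix s assume "s \<in> {x + y | x y. x \<in> max_part T \<and> y \<in> nfold_max_part n T}"
    then obtain x f where x: "s = x + (\<Sum>i<n. f i)" "x \<in> max_part T" "\<forall>i<n. f i \<in> max_part T"
      using Suc by (auto simp: nfold_max_part_def)
    \<comment> \<open>The new summand takes the last index, which leaves the sum of the first \<open>n\<close> untouched.\<close>
    have "s = (\<Sum>i<Suc n. (f(n := x)) i)" using x(1) by simp
    moreover have "\<forall>i<Suc n. (f(n := x)) i \<in> max_part T" using x by (simp add: less_Suc_eq)
    ultimately have "s \<in> {\<Sum>i<Suc n. g i | g. \<forall>i<Suc n. g i \<in> max_part T}" by blast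
    then show "s \<in> nfold_max_part (Suc n) T"
      by (simp add: nfold_max_part_def del: sum.lessThan_Suc)
  qed
qed

lemma nfold_1: "nfold_max_part (Suc 0) T = max_part T"
  by (force simp: nfold_max_part_def)

lemma nfold_SucI: "x \<in> max_part T \<Longrightarrow> y \<in> nfold_max_part n T \<Longrightarrow> x + y \<in> nfold_max_part (Suc n) T"
  unfolding nfold_Suc by blast

lemma nfold_SucE:
  assumes "s \<in> nfold_max_part (Suc n) T"
  obtains x y where "s = x + y" "x \<in> max_part T" "y \<in> nfold_max_part n T"
  using assms unfolding nfold_Suc by blast

lemma add_nfold: "t \<in> T \<Longrightarrow> x \<in> nfold_max_part n T \<Longrightarrow> t + x \<in> nfold_max_part n T"
proof (induction n arbitrary: x)
  case 0 then show ?case by (simp add: add_in)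
next
  case (Suc n)
  obtain u v where "x = u + v" "u \<in> max_part T" "v \<in> nfold_max_part n T"
    using Suc.prems(2) by (rule nfold_SucE)
  then show ?case using nfold_SucI[of u "t + v" n] Suc by (simp add: ac_simps)
qed

lemma nfold_add:
  "x \<in> nfold_max_part n T \<Longrightarrow> y \<in> nfold_max_part k T \<Longrightarrow> x + y \<in> nfold_max_part (n + k) T"
proof (induction n arbitrary: x)
  case 0 then show ?case by (simp add: add_nfold)
next
  case (Suc n)
  obtain u v where "x = u + v" "u \<in> max_part T" "v \<in> nfold_max_part n T"
    using Suc.prems(1) by (rule nfold_SucE)
  then show ?case using nfold_SucI[of u "v + y" "n + k"] Suc by (simp add: ac_simps)
qed

lemma nfold_Suc_subset: "nfold_max_part (Suc n) T \<subseteq> nfold_max_part n T"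
  by (auto simp: max_part_def elim!: nfold_SucE intro: add_nfold)

lemma nfold_antimono: "n \<le> k \<Longrightarrow> nfold_max_part k T \<subseteq> nfold_max_part n T"
  using lift_Suc_antimono_le[of "\<lambda>n. nfold_max_part n T" n k] nfold_Suc_subset by blast

lemma nfold_subset: "nfold_max_part n T \<subseteq> T"
  using nfold_antimono[of 0 n] by simp

lemma nfold_ge: "x \<in> nfold_max_part n T \<Longrightarrow> n \<le> x"
proof (induction n arbitrary: x)
  case (Suc n) then show ?case by (fastforce simp: max_part_def elim!: nfold_SucE)
qed simp

text \<open>
Elements of \<open>max_part T\<close> are positive, so a sum of \<open>n\<close> of them is at least \<open>n\<close>. This makes the
maximum in the definition of the order a maximum of a finite set.
\<close>
lemma nfold_iff_le_ord:
  assumes "s \<in> T" shows "s \<in> nfold_max_part n T \<longleftrightarrow> n \<le> ord_sg T s"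
proof -
  let ?N = "{n. s \<in> nfold_max_part n T}"
  have fin: "finite ?N" by (rule finite_subset[of _ "{..s}"]) (auto dest: nfold_ge)
  have "?N \<noteq> {}" using assms by (auto intro: exI[of _ 0])
  then have "s \<in> nfold_max_part (ord_sg T s) T" using Max_in[OF fin] by (simp add: ord_sg_def)
  then show ?thesis
    using Max_ge[OF fin] nfold_antimono by (auto simp: ord_sg_def)
qed

lemma nfold_ordI: "s \<in> T \<Longrightarrow> s \<in> nfold_max_part (ord_sg T s) T"
  by (simp add: nfold_iff_le_ord)

lemma ord_superadditive:
  assumes "x \<in> T" "y \<in> T" shows "ord_sg T x + ord_sg T y \<le> ord_sg T (x + y)"
  using nfold_add[OF nfold_ordI nfold_ordI, OF assms] assms by (simp add: nfold_iff_le_ord add_in)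

lemma ord_pos: "x \<in> max_part T \<Longrightarrow> 0 < ord_sg T x"
  using nfold_1 nfold_iff_le_ord[of x "Suc 0"] by (auto simp: max_part_def)

lemma nfold_diff_eq_ord:
  "nfold_max_part n T - nfold_max_part (Suc n) T = {s \<in> T. ord_sg T s = n}"
proof -
  have "s \<in> nfold_max_part j T \<longleftrightarrow> s \<in> T \<and> j \<le> ord_sg T s" for s j
    using nfold_subset nfold_iff_le_ord by blast
  then show ?thesis by auto
qed

end

locale fg_nat_submonoid = nat_submonoid +
  fixes A :: "nat set"
  assumes finite_generators: "finite A" and generated: "T = generated_semigroup A"
begin

lemma max_partE:
  assumes "x \<in> max_part T"
  obtains a t where "x = a + t" "a \<in> A \<inter> max_part T" "t \<in> T"
proof -
  have "x \<in> generated_semigroup A" "x \<noteq> 0" using assms generated by (auto simp: max_part_def)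
  then have "\<exists>a t. x = a + t \<and> a \<in> A \<inter> max_part T \<and> t \<in> T"
  proof induction
    case (add a s)
    show ?case
    proof (cases "a = 0")
      case False
      have "a \<in> T" using generated_semigroup.add[OF add.hyps(1) generated_semigroup.zero] generated by simp
      then show ?thesis using False add generated by (auto simp: max_part_def)
    qed (use add in auto)
  qed simp
  then show thesis using that by blast
qed

text \<open>
Every nonzero element of \<open>T\<close> is a nonzero generator plus an element of \<open>T\<close>, and the latter can be absorbed
into any of the other summands. Peeling off generators, of which there are finitely many, is what
makes the components of the tangent cone finite-dimensional and the powers of the maximal ideal
computable.
\<close>
lemma nfold_Suc_generatorE:
  assumes "x \<in> nfold_max_part (Suc n) T"
  obtains a y where "x = a + y" "a \<in> A \<inter> max_part T" "y \<in> nfold_max_part n T"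
proof -
  obtain u v where uv: "x = u + v" "u \<in> max_part T" "v \<in> nfold_max_part n T"
    using assms by (rule nfold_SucE)
  obtain a t where "u = a + t" "a \<in> A \<inter> max_part T" "t \<in> T" using uv(2) by (rule max_partE)
  then show thesis using that[of a "t + v"] uv add_nfold by (simp add: add.assoc)
qed

text \<open>
An element of order \<open>n + 1\<close> is a generator plus an element of order exactly \<open>n\<close>: superadditivity
prevents the second summand from having a larger order.
\<close>
lemma finite_ord_eq: "finite {s \<in> T. ord_sg T s = n}"
proof (induction n)
  case 0
  have "{s \<in> T. ord_sg T s = 0} \<subseteq> {0}" using ord_pos by (fastforce simp: max_part_def)
  then show ?case using finite_subset by blast
next
  case (Suc n)
  have "{s \<in> T. ord_sg T s = Suc n} \<subseteq> (\<Union>a\<in>A. (+) a ` {s \<in> T. ord_sg T s = n})"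
  proof
    fix x assume "x \<in> {s \<in> T. ord_sg T s = Suc n}"
    then have x: "x \<in> T" "ord_sg T x = Suc n" by auto
    then have "x \<in> nfold_max_part (Suc n) T" by (simp add: nfold_iff_le_ord)
    then obtain a y where a: "x = a + y" "a \<in> A \<inter> max_part T" "y \<in> nfold_max_part n T"
      by (rule nfold_Suc_generatorE)
    have y: "y \<in> T" using a(3) nfold_subset by blast
    have "ord_sg T a + ord_sg T y \<le> Suc n"
      using ord_superadditive[of a y] a y x by (simp add: max_part_def)
    then have "ord_sg T y = n" using ord_pos[of a] a nfold_iff_le_ord[OF y, of n] by simp
    then show "x \<in> (\<Union>a\<in>A. (+) a ` {s \<in> T. ord_sg T s = n})" using a y by blast
  qed
  then show ?case using Suc finite_generators by (meson finite_UN finite_imageI finite_subset)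
qed

lemma finite_ord_le: "finite {s \<in> T. ord_sg T s \<le> n}"
proof -
  have "{s \<in> T. ord_sg T s \<le> n} = (\<Union>k\<le>n. {s \<in> T. ord_sg T s = k})" by auto
  then show ?thesis using finite_ord_eq by simp
qed

end

lemma nat_submonoid_generated: "nat_submonoid (generated_semigroup A)"
proof
  show "a + b \<in> generated_semigroup A"
    if "a \<in> generated_semigroup A" "b \<in> generated_semigroup A" for a b
    using that by induction (auto simp: add.assoc intro: generated_semigroup.add)
qed (rule generated_semigroup.zero)

lemma fg_nat_submonoid_generated: "finite A \<Longrightarrow> fg_nat_submonoid (generated_semigroup A) A"
  by (simp add: fg_nat_submonoid_def fg_nat_submonoid_axioms_def nat_submonoid_generated)

section \<open>The reduction number and the growth of orders\<close>

locale cofinite_nat_submonoid = nat_submonoid +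
  assumes cofinite: "finite (- T)"
begin

lemma multiplicity_in: "multiplicity_sg T \<in> max_part T"
proof -
  have "finite (insert 0 (- T))" using cofinite by simp
  then obtain x where "x \<notin> insert 0 (- T)" using ex_new_if_finite infinite_UNIV_nat by blast
  then have "x \<in> max_part T" by (auto simp: max_part_def)
  then show ?thesis unfolding multiplicity_sg_def by (rule LeastI)
qed

lemma multiplicity_le: "x \<in> max_part T \<Longrightarrow> multiplicity_sg T \<le> x"
  unfolding multiplicity_sg_def by (rule Least_le)

lemma shift_nfold_subset: "(+) (multiplicity_sg T) ` nfold_max_part n T \<subseteq> nfold_max_part (Suc n) T"
  using nfold_SucI[OF multiplicity_in] by blast

lemma sum_in_nfold: "finite I \<Longrightarrow> (\<And>i. i \<in> I \<Longrightarrow> f i \<in> max_part T) \<Longrightarrow> sum f I \<in> nfold_max_part (card I) T"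
proof (induction rule: finite_induct)
  case (insert x F) then show ?case by (simp add: nfold_SucI)
qed (simp add: zero_in)

lemma mult_multiplicity_in_nfold: "multiplicity_sg T * c \<in> nfold_max_part c T"
  using sum_in_nfold[of "{..<c}" "\<lambda>_. multiplicity_sg T"] multiplicity_in by (simp add: mult.commute)

text \<open>
Existence of a reduction number, by a pigeonhole argument. Let \<open>e\<close> be the multiplicity. Among at least
\<open>e\<close> summands there is a nonempty block whose sum is a multiple \<open>e c\<close> of \<open>e\<close>. As every summand is at
least \<open>e\<close>, the block has at most \<open>c\<close> members, so it may be replaced by \<open>c\<close> copies of \<open>e\<close> without
losing summands, and one of these copies is split off.
\<close>
lemma nfold_shift_large:
  assumes "multiplicity_sg T \<le> Suc n"
  shows "nfold_max_part (Suc n) T = (+) (multiplicity_sg T) ` nfold_max_part n T"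
proof (intro equalityI subsetI)
  let ?e = "multiplicity_sg T"
  have e: "0 < ?e" using multiplicity_in by (simp add: max_part_def)
  fix s assume "s \<in> nfold_max_part (Suc n) T"
  then obtain f where f: "s = (\<Sum>i<Suc n. f i)" "\<forall>i<Suc n. f i \<in> max_part T"
    by (auto simp: nfold_max_part_def)
  define P where "P j = (\<Sum>i<j. f i)" for j
  \<comment> \<open>There are \<open>e + 1\<close> partial sums with index at most \<open>e\<close>, but only \<open>e\<close> residues.\<close>
  have "\<not> inj_on (\<lambda>j. P j mod ?e) {..?e}"
  proof (rule pigeonhole)
    have "(\<lambda>j. P j mod ?e) ` {..?e} \<subseteq> {..<?e}" using e by auto
    then have "card ((\<lambda>j. P j mod ?e) ` {..?e}) \<le> card {..<?e}" by (intro card_mono) auto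
    then show "card ((\<lambda>j. P j mod ?e) ` {..?e}) < card {..?e}" by simp
  qed
  then obtain i j where ij: "i < j" "j \<le> ?e" "P i mod ?e = P j mod ?e"
    unfolding inj_on_def by (metis atMost_iff linorder_neqE_nat)
  have split: "P j = P i + sum f {i..<j}"
    unfolding P_def using ij(1)
    by (metis atLeast0LessThan less_imp_le_nat sum.atLeastLessThan_concat zero_le)
  have "?e dvd sum f {i..<j}"
    using ij(3) split mod_eq_dvd_iff_nat[of "P i" "P j" ?e] by simp
  then obtain c where c: "sum f {i..<j} = ?e * c" by blast
  have "(j - i) * ?e \<le> sum f {i..<j}"
    using sum_mono[of "{i..<j}" "\<lambda>_. ?e" f] multiplicity_le f(2) ij assms by simp
  then have cge: "j - i \<le> c" using c e by (simp add: mult.commute)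
  let ?I = "{..<Suc n} - {i..<j}"
  have "s = sum f ?I + sum f {i..<j}"
    unfolding f(1) using ij assms by (intro sum.subset_diff) auto
  then have s: "s = ?e + (sum f ?I + ?e * (c - 1))"
    using c cge ij(1) by (cases c) auto
  have "sum f ?I \<in> nfold_max_part (card ?I) T" using f(2) by (intro sum_in_nfold) auto
  then have "sum f ?I + ?e * (c - 1) \<in> nfold_max_part (card ?I + (c - 1)) T"
    using nfold_add mult_multiplicity_in_nfold by blast
  moreover have "card ?I = Suc n - (j - i)"
    using ij assms by (subst card_Diff_subset) auto
  then have "n \<le> card ?I + (c - 1)" using cge ij assms by linarith
  ultimately have "sum f ?I + ?e * (c - 1) \<in> nfold_max_part n T" using nfold_antimono by blast
  then show "s \<in> (+) ?e ` nfold_max_part n T" using s by blast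
qed (use shift_nfold_subset in blast)

lemma reduction_number_shift:
  "nfold_max_part (Suc (reduction_number T)) T
    = (+) (multiplicity_sg T) ` nfold_max_part (reduction_number T) T"
proof -
  have "nfold_max_part (multiplicity_sg T + 1) T
          = (+) (multiplicity_sg T) ` nfold_max_part (multiplicity_sg T) T"
    using nfold_shift_large[of "multiplicity_sg T"] by simp
  from LeastI[of "\<lambda>r. nfold_max_part (r + 1) T = (+) (multiplicity_sg T) ` nfold_max_part r T", OF this]
  show ?thesis unfolding reduction_number_def by simp
qed

lemma nfold_shift:
  "reduction_number T \<le> n \<Longrightarrow> nfold_max_part (Suc n) T = (+) (multiplicity_sg T) ` nfold_max_part n T"
proof (induction rule: dec_induct)
  case base show ?case by (rule reduction_number_shift)
next
  case (step n)
  show ?case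
  proof (intro equalityI subsetI)
    fix s assume "s \<in> nfold_max_part (Suc (Suc n)) T"
    then obtain u v where uv: "s = u + v" "u \<in> max_part T" "v \<in> nfold_max_part (Suc n) T"
      by (rule nfold_SucE)
    then obtain w where "v = multiplicity_sg T + w" "w \<in> nfold_max_part n T" using step.IH by blast
    then have "s = multiplicity_sg T + (u + w)" "u + w \<in> nfold_max_part (Suc n) T"
      using uv nfold_SucI by auto
    then show "s \<in> (+) (multiplicity_sg T) ` nfold_max_part (Suc n) T" by blast
  qed (use shift_nfold_subset in blast)
qed

text \<open>
If \<open>n\<close> is at least the reduction number, then every sum of \<open>n + 1\<close> nonzero elements is the
multiplicity plus a sum of \<open>n\<close> nonzero elements. Removing the multiplicity therefore lowers the order
by at most one.
\<close>
lemma ord_add_multiplicity: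
  assumes "x \<in> T" "reduction_number T \<le> ord_sg T x"
  shows "ord_sg T (multiplicity_sg T + x) = Suc (ord_sg T x)"
proof (rule antisym)
  have e: "multiplicity_sg T \<in> T" using multiplicity_in by (simp add: max_part_def)
  show ge: "Suc (ord_sg T x) \<le> ord_sg T (multiplicity_sg T + x)"
    using ord_superadditive[OF e assms(1)] ord_pos[OF multiplicity_in] by linarith
  let ?N = "ord_sg T (multiplicity_sg T + x)"
  have "multiplicity_sg T + x \<in> nfold_max_part (Suc (?N - 1)) T"
    using nfold_ordI[OF add_in[OF e assms(1)]] ge by (cases ?N) auto
  then have "x \<in> nfold_max_part (?N - 1) T"
    using nfold_shift[of "?N - 1"] ge assms(2) by auto
  then show "?N \<le> Suc (ord_sg T x)" using assms(1) by (simp add: nfold_iff_le_ord)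
qed

end

locale fg_cofinite_nat_submonoid = fg_nat_submonoid + cofinite_nat_submonoid
begin

text \<open>
The constant \<open>l_sg x T\<close> is a maximum over elements of order at most the reduction number. An element
of larger order is the multiplicity plus an element whose order is smaller by one, and both sides of
the inequality drop by one when the multiplicity is removed. Induction then reaches the finite range.
\<close>
lemma ord_add_le:
  assumes "x \<in> T" "s \<in> T"
  shows "int (ord_sg T (s + x)) \<le> int (ord_sg T s) + int (ord_sg T x) + l_sg x T"
  using assms(2)
proof (induction s rule: less_induct)
  case (less s)
  show ?case
  proof (cases "ord_sg T s \<le> reduction_number T")
    case True
    let ?g = "\<lambda>s. int (ord_sg T (s + x)) - int (ord_sg T x) - int (ord_sg T s)"
    let ?D = "{s \<in> T. ord_sg T s \<le> reduction_number T}"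
    have "?g s \<le> Max (?g ` ?D)" using True less.prems finite_ord_le by (intro Max_ge) auto
    also have "?g ` ?D = {?g s | s. s \<in> T \<and> ord_sg T s \<le> reduction_number T}" by blast
    finally show ?thesis by (simp add: l_sg_def)
  next
    case False
    let ?e = "multiplicity_sg T"
    have e: "0 < ?e" using multiplicity_in by (simp add: max_part_def)
    obtain n where n: "ord_sg T s = Suc n" using False by (cases "ord_sg T s") auto
    then have "s \<in> nfold_max_part (Suc n) T" using nfold_ordI[OF less.prems] by simp
    then obtain t where t: "s = ?e + t" "t \<in> nfold_max_part n T"
      using nfold_shift[of n] False n by auto
    have tT: "t \<in> T" and nt: "n \<le> ord_sg T t"
      using t(2) nfold_subset nfold_iff_le_ord by blast+
    have "reduction_number T \<le> ord_sg T t" using nt False n by linarith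
    moreover have "ord_sg T t \<le> ord_sg T (t + x)"
      using ord_superadditive[OF tT assms(1)] by simp
    ultimately have "ord_sg T s = Suc (ord_sg T t)" "ord_sg T (s + x) = Suc (ord_sg T (t + x))"
      using ord_add_multiplicity[OF tT] ord_add_multiplicity[OF add_in[OF tT assms(1)]]
      by (simp_all add: t(1) add.assoc)
    then show ?thesis using less.IH[of t] t(1) e tT by simp
  qed
qed

end

section \<open>Powers of the maximal ideal\<close>

definition supported_in :: "nat set \<Rightarrow> 'k::field fps set" where
  "supported_in U = {f. \<forall>n. fps_nth f n \<noteq> 0 \<longrightarrow> n \<in> U}"

lemma supported_in_0 [simp]: "0 \<in> supported_in U"
  by (simp add: supported_in_def)

lemma supported_in_mono: "U \<subseteq> V \<Longrightarrow> supported_in U \<subseteq> supported_in V"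
  by (auto simp: supported_in_def)

lemma supported_in_add: "f \<in> supported_in U \<Longrightarrow> g \<in> supported_in U \<Longrightarrow> f + g \<in> supported_in U"
  by (force simp: supported_in_def)

lemma supported_in_uminus: "f \<in> supported_in U \<Longrightarrow> - f \<in> supported_in U"
  by (auto simp: supported_in_def)

lemma supported_in_diff: "f \<in> supported_in U \<Longrightarrow> g \<in> supported_in U \<Longrightarrow> f - g \<in> supported_in U"
  by (force simp: supported_in_def)

lemma supported_in_X_power: "s \<in> U \<Longrightarrow> fps_X ^ s \<in> supported_in U"
  by (auto simp: supported_in_def)

lemma supported_in_const: "0 \<in> U \<Longrightarrow> fps_const c \<in> supported_in U"
  by (auto simp: supported_in_def)

lemma supported_in_const_mult: "f \<in> supported_in U \<Longrightarrow> fps_const c * f \<in> supported_in U"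
  by (auto simp: supported_in_def)

lemma supported_in_mult:
  assumes "f \<in> supported_in U" "g \<in> supported_in V" "\<And>u v. u \<in> U \<Longrightarrow> v \<in> V \<Longrightarrow> u + v \<in> W"
  shows "f * g \<in> supported_in W"
  unfolding supported_in_def
proof (intro CollectI allI impI)
  fix n assume "fps_nth (f * g) n \<noteq> 0"
  then obtain i where i: "i \<in> {0..n}" "fps_nth f i * fps_nth g (n - i) \<noteq> 0"
    unfolding fps_mult_nth by (metis (lifting) sum.neutral)
  then have "i \<in> U" "n - i \<in> V" using assms(1,2) by (auto simp: supported_in_def)
  then show "n \<in> W" using assms(3)[of i "n - i"] i(1) by simp
qed

text \<open>
A series whose support is covered by finitely many translates \<open>a + V\<close> is a finite sum of
monomial multiples \<open>X\<^sup>a g\<close> with \<open>g\<close> supported in \<open>V\<close>. Finiteness is essential: it turns an infinite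
sum of monomials into a finite algebraic combination, so that ideals, which are closed under finite
sums only, contain it.
\<close>
lemma supported_in_shifts_induct [consumes 2, case_names zero add monomial_mult]:
  assumes "f \<in> supported_in (\<Union>a\<in>A. (+) a ` V)" "finite A"
    and zero: "P 0"
    and add: "\<And>f g. P f \<Longrightarrow> P g \<Longrightarrow> P (f + g)"
    and monomial_mult: "\<And>a g. a \<in> A \<Longrightarrow> g \<in> supported_in V \<Longrightarrow> P (fps_X ^ a * g)"
  shows "P f"
  using assms(2,1,5)
proof (induction A arbitrary: f rule: finite_induct)
  case empty
  then have "f = 0" by (simp add: supported_in_def fps_eq_iff)
  then show ?case using zero by simp
next
  case (insert a A)
  \<comment> \<open>\<open>X\<^sup>a h\<close> is the part of \<open>f\<close> with exponents in \<open>a + V\<close>.\<close>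
  define h where "h = Abs_fps (\<lambda>n. if n \<in> V then fps_nth f (n + a) else 0)"
  have h: "h \<in> supported_in V" by (auto simp: supported_in_def h_def)
  have "f - fps_X ^ a * h \<in> supported_in (\<Union>a\<in>A. (+) a ` V)"
    unfolding supported_in_def
  proof (intro CollectI allI impI)
    fix n assume n: "fps_nth (f - fps_X ^ a * h) n \<noteq> 0"
    have "n \<notin> (+) a ` V"
      using n by (auto simp: fps_X_power_mult_nth h_def ac_simps)
    moreover from this have "fps_nth f n \<noteq> 0"
      using n by (auto simp: fps_X_power_mult_nth h_def image_iff split: if_splits)
    ultimately show "n \<in> (\<Union>a\<in>A. (+) a ` V)"
      using insert.prems(1) unfolding supported_in_def by blast
  qed
  then have "P (f - fps_X ^ a * h)" using insert.IH insert.prems(2) by blast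
  then have "P ((f - fps_X ^ a * h) + fps_X ^ a * h)" using add insert.prems(2) h by blast
  then show ?case by simp
qed

lemma carrier_semigroup_ring [simp]: "carrier (semigroup_ring T) = supported_in T"
  and mult_semigroup_ring [simp]: "monoid.mult (semigroup_ring T) = (*)"
  and one_semigroup_ring [simp]: "one (semigroup_ring T) = 1"
  and zero_semigroup_ring [simp]: "zero (semigroup_ring T) = 0"
  and add_semigroup_ring [simp]: "add (semigroup_ring T) = (+)"
  by (simp_all add: semigroup_ring_def supported_in_def)

context nat_submonoid
begin

lemma mult_supported_in:
  "f \<in> supported_in T \<Longrightarrow> g \<in> supported_in U \<Longrightarrow> (\<And>t u. t \<in> T \<Longrightarrow> u \<in> U \<Longrightarrow> t + u \<in> U) \<Longrightarrow>
    f * g \<in> supported_in U"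
  by (rule supported_in_mult)

lemma cring_semigroup_ring: "cring (semigroup_ring T :: 'k::field fps ring)"
proof (rule cringI)
  show "abelian_group (semigroup_ring T :: 'k fps ring)"
  proof (rule abelian_groupI)
    fix x :: "'k fps" assume "x \<in> carrier (semigroup_ring T)"
    then show "\<exists>y\<in>carrier (semigroup_ring T). y \<oplus>\<^bsub>semigroup_ring T\<^esub> x = \<zero>\<^bsub>semigroup_ring T\<^esub>"
      by (auto intro!: bexI[of _ "- x"] supported_in_uminus)
  qed (auto intro: supported_in_add)
  have "1 = fps_const (1::'k)" by simp
  then have "(1 :: 'k fps) \<in> supported_in T" using zero_in supported_in_const by metis
  then show "comm_monoid (semigroup_ring T :: 'k fps ring)"
    by (intro comm_monoidI) (auto intro: supported_in_mult add_in)
qed (auto simp: algebra_simps)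

lemma ideal_supported_in:
  assumes "U \<subseteq> T" "\<And>t u. t \<in> T \<Longrightarrow> u \<in> U \<Longrightarrow> t + u \<in> U"
  shows "ideal (supported_in U :: 'k::field fps set) (semigroup_ring T)"
proof -
  interpret R: cring "semigroup_ring T :: 'k fps ring" by (rule cring_semigroup_ring)
  show ?thesis
  proof (rule idealI)
    show "subgroup (supported_in U) (add_monoid (semigroup_ring T :: 'k fps ring))"
    proof (rule R.add.subgroupI)
      fix a :: "'k fps" assume a: "a \<in> supported_in U"
      then have "a \<in> supported_in T" "- a \<in> supported_in T"
        using supported_in_mono[OF assms(1)] supported_in_uminus by blast+
      then have "\<ominus>\<^bsub>semigroup_ring T\<^esub> a = - a" by (intro R.minus_equality) auto
      then show "\<ominus>\<^bsub>semigroup_ring T\<^esub> a \<in> supported_in U" using a supported_in_uminus by simp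
    next
      show "supported_in U \<noteq> ({} :: 'k fps set)" using supported_in_0 by blast
    qed (use supported_in_mono[OF assms(1)] supported_in_add in auto)
  next
    show mult: "x \<otimes>\<^bsub>semigroup_ring T\<^esub> a \<in> supported_in U"
      if "a \<in> supported_in U" "x \<in> carrier (semigroup_ring T)" for a x :: "'k fps"
      using mult_supported_in[of x a U] that assms(2) by simp
    show "a \<otimes>\<^bsub>semigroup_ring T\<^esub> x \<in> supported_in U"
      if "a \<in> supported_in U" "x \<in> carrier (semigroup_ring T)" for a x :: "'k fps"
      using mult[OF that] by (simp add: mult.commute)
  qed (rule R.ring_axioms)
qed

end

context fg_nat_submonoid
begin

lemma nfold_Suc_subset_shifts:
  "nfold_max_part (Suc n) T \<subseteq> (\<Union>a\<in>A \<inter> max_part T. (+) a ` nfold_max_part n T)"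
proof
  fix x assume "x \<in> nfold_max_part (Suc n) T"
  then show "x \<in> (\<Union>a\<in>A \<inter> max_part T. (+) a ` nfold_max_part n T)"
    by (rule nfold_Suc_generatorE) blast
qed

lemma ideal_nfold: "ideal (supported_in (nfold_max_part n T) :: 'k::field fps set) (semigroup_ring T)"
  by (intro ideal_supported_in nfold_subset add_nfold)

lemma max_ideal_eq: "(max_ideal T :: 'k::field fps set) = supported_in (max_part T)"
proof (intro equalityI subsetI)
  interpret R: cring "semigroup_ring T :: 'k fps ring" by (rule cring_semigroup_ring)
  let ?X = "{fps_X ^ s | s. s \<in> max_part T} :: 'k fps set"
  have X: "?X \<subseteq> supported_in (max_part T)" using supported_in_X_power by blast
  show "f \<in> supported_in (max_part T)" if "f \<in> max_ideal T" for f :: "'k fps"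
    using that R.genideal_minimal[OF ideal_nfold[of "Suc 0"], of ?X] X
    unfolding max_ideal_def nfold_1 by blast
  fix f :: "'k fps" assume f: "f \<in> supported_in (max_part T)"
  have "?X \<subseteq> carrier (semigroup_ring T)"
    using X supported_in_mono[of "max_part T" T] by (auto simp: max_part_def)
  then interpret I: ideal "max_ideal T" "semigroup_ring T :: 'k fps ring"
    unfolding max_ideal_def by (rule R.genideal_ideal)
  have "f \<in> supported_in (\<Union>a\<in>A \<inter> max_part T. (+) a ` T)"
    using f supported_in_mono[OF nfold_Suc_subset_shifts[of 0]] unfolding nfold_1 by auto
  moreover have "finite (A \<inter> max_part T)" using finite_generators by simp
  ultimately show "f \<in> max_ideal T"
  proof (induction rule: supported_in_shifts_induct)
    case zero show ?case using I.zero_closed by simp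
  next
    case (add f g) then show ?case using I.a_closed by simp
  next
    case (monomial_mult a g)
    then have "fps_X ^ a \<in> (max_ideal T :: 'k fps set)"
      unfolding max_ideal_def genideal_def by blast
    then show ?case using I.I_r_closed[of "fps_X ^ a" g] monomial_mult by simp
  qed
qed

text \<open>
The nontrivial inclusion splits a series supported in \<open>(n + 1)M\<close> along the finitely many translates
\<open>a + nM\<close>, with \<open>a\<close> a nonzero generator.
\<close>
lemma ideal_prod_nfold:
  "ideal_prod (semigroup_ring T) (supported_in (nfold_max_part n T) :: 'k::field fps set)
     (supported_in (max_part T)) = supported_in (nfold_max_part (Suc n) T)" (is "?L = ?R")
proof (intro equalityI subsetI)
  fix f assume "f \<in> ?L"
  then show "f \<in> ?R"
  proof induction
    case (prod i j)
    have "u + v \<in> nfold_max_part (Suc n) T" if "u \<in> nfold_max_part n T" "v \<in> max_part T" for u v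
      using nfold_SucI[OF that(2,1)] by (simp add: add.commute)
    then show ?case using supported_in_mult[OF prod] by simp
  next
    case (sum s1 s2) then show ?case using supported_in_add by simp
  qed
next
  fix f assume f: "f \<in> ?R"
  have "f \<in> supported_in (\<Union>a\<in>A \<inter> max_part T. (+) a ` nfold_max_part n T)"
    using f supported_in_mono[OF nfold_Suc_subset_shifts] by blast
  moreover have "finite (A \<inter> max_part T)" using finite_generators by simp
  ultimately show "f \<in> ?L"
  proof (induction rule: supported_in_shifts_induct)
    case zero
    show ?case using ideal_prod.prod[of 0 _ 0 _ "semigroup_ring T :: 'k fps ring"] by simp
  next
    case (add f g)
    then show ?case using ideal_prod.sum[of f "semigroup_ring T"] by simp
  next
    case (monomial_mult a g)
    then have "fps_X ^ a \<in> (supported_in (max_part T) :: 'k fps set)"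
      using supported_in_X_power by blast
    from ideal_prod.prod[OF monomial_mult(2) this, of "semigroup_ring T"]
    show ?case by (simp add: mult.commute)
  qed
qed

lemma max_ideal_power_eq:
  "(max_ideal_power T n :: 'k::field fps set) = supported_in (nfold_max_part n T)"
proof (induction n)
  case 0 show ?case by (simp add: max_ideal_power_def ideals_set_def nat_pow_def)
next
  case (Suc n)
  have "max_ideal_power T (Suc n)
    = ideal_prod (semigroup_ring T) (max_ideal_power T n) (max_ideal T :: 'k fps set)"
    by (simp add: max_ideal_power_def ideals_set_def nat_pow_def)
  then show ?case using Suc ideal_prod_nfold by (simp add: max_ideal_eq)
qed

end

section \<open>Length of quotients of monomial ideals\<close>

definition coset_mod :: "nat set \<Rightarrow> 'k::field fps \<Rightarrow> 'k fps set" where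
  "coset_mod V f = {g. g - f \<in> supported_in V}"

lemma a_r_coset_supported_in: "supported_in V +>\<^bsub>semigroup_ring T\<^esub> f = coset_mod V f"
proof -
  have "g \<in> (\<lambda>h. h + f) ` supported_in V \<longleftrightarrow> g \<in> coset_mod V f" for g
    by (auto simp: coset_mod_def image_iff intro!: bexI[of _ "g - f"])
  then show ?thesis by (auto simp: a_r_coset_def')
qed

lemma coset_mod_eq_iff: "coset_mod V f = coset_mod V g \<longleftrightarrow> f - g \<in> supported_in V"
proof
  assume "coset_mod V f = coset_mod V g"
  moreover have "f \<in> coset_mod V f" by (simp add: coset_mod_def)
  ultimately show "f - g \<in> supported_in V" by (simp add: coset_mod_def)
next
  assume d: "f - g \<in> supported_in V"
  have "h - f \<in> supported_in V \<longleftrightarrow> h - g \<in> supported_in V" for h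
    using supported_in_add[OF _ d, of "h - f"] supported_in_diff[OF _ d, of "h - g"] by auto
  then show "coset_mod V f = coset_mod V g" by (simp add: coset_mod_def)
qed

lemma set_add_coset_mod:
  "coset_mod V f <+>\<^bsub>semigroup_ring T\<^esub> coset_mod V g = coset_mod V (f + g)"
proof (intro equalityI subsetI)
  fix x assume "x \<in> coset_mod V f <+>\<^bsub>semigroup_ring T\<^esub> coset_mod V g"
  then obtain a b where ab: "x = a + b" "a - f \<in> supported_in V" "b - g \<in> supported_in V"
    by (auto simp: set_add_def' coset_mod_def)
  have "x - (f + g) = (a - f) + (b - g)" using ab(1) by simp
  also have "\<dots> \<in> supported_in V" using ab(2,3) by (rule supported_in_add)
  finally show "x \<in> coset_mod V (f + g)" by (simp add: coset_mod_def)
next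
  fix x assume "x \<in> coset_mod V (f + g)"
  then have "x - g \<in> coset_mod V f" "g \<in> coset_mod V g" "x = (x - g) + g"
    by (simp_all add: coset_mod_def algebra_simps)
  then show "x \<in> coset_mod V f <+>\<^bsub>semigroup_ring T\<^esub> coset_mod V g"
    unfolding set_add_def' by force
qed

text \<open>
Only the coefficients at exponents in \<open>D\<close> matter; the leading exponent of a series is the least
exponent in \<open>D\<close> at which it does not vanish. For \<open>D = U - V\<close>, these are the pivot columns of a
subspace of the series supported in \<open>U\<close> modulo those supported in \<open>V\<close>.
\<close>
definition leading_exponents :: "nat set \<Rightarrow> 'k::field fps set \<Rightarrow> nat set" where
  "leading_exponents D L = {d \<in> D. \<exists>f\<in>L. fps_nth f d \<noteq> 0 \<and> (\<forall>x\<in>D. x < d \<longrightarrow> fps_nth f x = 0)}"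

text \<open>
Gaussian elimination: nested subspaces with the same leading exponents are equal. A series in the
larger subspace is reduced by subtracting multiples of members of the smaller one, which pushes its
leading exponent upwards until it vanishes on all of \<open>D\<close>.
\<close>
lemma subset_if_leading_exponents_subset:
  fixes L L' :: "'k::field fps set"
  assumes "finite D"
    and L: "\<And>f g c. f \<in> L \<Longrightarrow> g \<in> L \<Longrightarrow> f + fps_const c * g \<in> L"
    and L': "\<And>f g c. f \<in> L' \<Longrightarrow> g \<in> L' \<Longrightarrow> f + fps_const c * g \<in> L'"
    and "L \<subseteq> L'"
    and vanish: "\<And>f. f \<in> L' \<Longrightarrow> (\<forall>x\<in>D. fps_nth f x = 0) \<Longrightarrow> f \<in> L"
    and lead: "leading_exponents D L' \<subseteq> leading_exponents D L"
  shows "L' \<subseteq> L"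
proof -
  obtain B where B: "\<forall>x\<in>D. x < B" using assms(1) finite_nat_set_iff_bounded by blast
  \<comment> \<open>The induction runs downwards from the upper end of \<open>D\<close>; \<open>j\<close> is the width of the window
    below \<open>B\<close> in which \<open>f\<close> may still be nonzero.\<close>
  have "f \<in> L" if "f \<in> L'" "\<forall>x\<in>D. x + j < B \<longrightarrow> fps_nth f x = 0" for f j
    using that
  proof (induction j arbitrary: f)
    case 0 then show ?case using vanish B by simp
  next
    case (Suc j)
    show ?case
    proof (cases "\<exists>d\<in>D. d + Suc j = B \<and> fps_nth f d \<noteq> 0")
      case True
      then obtain d where d: "d \<in> D" "d + Suc j = B" "fps_nth f d \<noteq> 0" by blast
      then have "d \<in> leading_exponents D L'"
        using Suc.prems by (auto simp: leading_exponents_def)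
      then obtain g where g: "g \<in> L" "fps_nth g d \<noteq> 0" "\<forall>x\<in>D. x < d \<longrightarrow> fps_nth g x = 0"
        using lead by (auto simp: leading_exponents_def)
      define c where "c = fps_nth f d / fps_nth g d"
      have "f + fps_const (- c) * g \<in> L"
      proof (rule Suc.IH)
        show "f + fps_const (- c) * g \<in> L'" using L' Suc.prems(1) g(1) assms(4) by blast
        have "fps_nth (f + fps_const (- c) * g) x = 0" if "x \<in> D" "x + j < B" for x
        proof (cases "x = d")
          case True then show ?thesis using g(2) by (simp add: c_def)
        next
          case False
          then have "x < d" using that d(2) by simp
          then show ?thesis using that g(3) Suc.prems(2) d(2) by simp
        qed
        then show "\<forall>x\<in>D. x + j < B \<longrightarrow> fps_nth (f + fps_const (- c) * g) x = 0" by blast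
      qed
      then have "(f + fps_const (- c) * g) + fps_const c * g \<in> L" using L g(1) by blast
      then show ?thesis by (simp flip: fps_const_neg)
    next
      case False
      then have "\<forall>x\<in>D. x + j < B \<longrightarrow> fps_nth f x = 0"
        using Suc.prems(2) by (metis Suc_lessI add_Suc_right)
      then show ?thesis using Suc.IH Suc.prems(1) by blast
    qed
  qed
  from this[of _ B] show ?thesis by auto
qed

text \<open>
Distinct elements of \<open>D\<close> have different numbers of larger elements in \<open>D\<close>, so by counting every
number below \<open>card D\<close> occurs. This enumerates \<open>D\<close> in decreasing order.
\<close>
lemma ex_card_greater_eq:
  fixes D :: "nat set"
  assumes "finite D" "i < card D"
  shows "\<exists>d\<in>D. card {x \<in> D. d < x} = i"
proof -
  let ?r = "\<lambda>d. card {x \<in> D. d < x}"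
  have less: "?r b < ?r a" if "a \<in> D" "b \<in> D" "a < b" for a b
    using that assms(1) by (intro psubset_card_mono) auto
  then have "inj_on ?r D" by (metis (lifting) inj_onI less_irrefl linorder_neqE_nat)
  then have "card (?r ` D) = card {..<card D}" by (simp add: card_image)
  moreover have "?r ` D \<subseteq> {..<card D}"
    using assms(1) by (auto intro!: psubset_card_mono)
  ultimately have "?r ` D = {..<card D}" by (intro card_subset_eq) auto
  then show ?thesis using assms(2) by (metis (lifting) image_iff lessThan_iff)
qed

text \<open>
The quotient of two monomial ideals, given by sets \<open>V \<subseteq> U\<close> of exponents that absorb addition of
elements of \<open>T\<close>.
\<close>

locale monomial_quotient = nat_submonoid +
  fixes U V :: "nat set"
  assumes sub: "V \<subseteq> U" "U \<subseteq> T"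
    and U_absorb: "t \<in> T \<Longrightarrow> u \<in> U \<Longrightarrow> t + u \<in> U"
    and V_absorb: "t \<in> T \<Longrightarrow> v \<in> V \<Longrightarrow> t + v \<in> V"
    and finite_diff: "finite (U - V)"
begin

abbreviation quotient :: "('k::field fps, 'k fps set) module" where
  "quotient \<equiv> quot_module (semigroup_ring T) (supported_in U) (supported_in V)"

lemma carrier_quotient: "carrier quotient = coset_mod V ` supported_in U"
  by (auto simp: quot_module_def a_r_coset_supported_in)

lemma zero_quotient: "zero quotient = coset_mod V 0"
  by (simp add: quot_module_def coset_mod_def)

lemma add_quotient: "add quotient (coset_mod V f) (coset_mod V g) = coset_mod V (f + g)"
  by (simp add: quot_module_def set_add_coset_mod)

lemma smult_quotient:
  assumes "r \<in> supported_in T"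
  shows "smult quotient r (coset_mod V f) = coset_mod V (r * f)"
proof -
  have "coset_mod V (r * g) = coset_mod V (r * f)" if "g \<in> coset_mod V f" for g
  proof -
    have "g - f \<in> supported_in V" using that by (simp add: coset_mod_def)
    then have "r * (g - f) \<in> supported_in V" using mult_supported_in[OF assms _ V_absorb] by blast
    then show ?thesis by (simp add: coset_mod_eq_iff right_diff_distrib)
  qed
  then have "(\<Union>g\<in>coset_mod V f. coset_mod V (r * g)) = (\<Union>g\<in>coset_mod V f. coset_mod V (r * f))"
    by (intro SUP_cong refl)
  moreover have "f \<in> coset_mod V f" by (simp add: coset_mod_def)
  ultimately have "(\<Union>g\<in>coset_mod V f. coset_mod V (r * g)) = coset_mod V (r * f)" by blast
  then show ?thesis by (simp add: quot_module_def a_r_coset_supported_in)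
qed

lemma submodule_supported_in:
  assumes "V \<subseteq> W" "W \<subseteq> U" "\<And>t w. t \<in> T \<Longrightarrow> w \<in> W \<Longrightarrow> t + w \<in> W"
  shows "submodule (coset_mod V ` supported_in W) (semigroup_ring T) (quotient :: ('k::field fps, _) module)"
    (is "submodule ?N _ ?Q")
proof (intro submodule.intro subgroup.intro submodule_axioms.intro)
  show "?N \<subseteq> carrier (add_monoid ?Q)"
    using supported_in_mono[OF assms(2)] by (auto simp: carrier_quotient)
  show "X \<otimes>\<^bsub>add_monoid ?Q\<^esub> Y \<in> ?N" if "X \<in> ?N" "Y \<in> ?N" for X Y
    using that by (auto simp: add_quotient intro: supported_in_add)
  show "\<one>\<^bsub>add_monoid ?Q\<^esub> \<in> ?N"
    by (auto simp: zero_quotient)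
  show "inv\<^bsub>add_monoid ?Q\<^esub> X \<in> ?N" if X: "X \<in> ?N" for X
  proof -
    obtain f where f: "X = coset_mod V f" "f \<in> supported_in W" using X by blast
    then have fU: "- f \<in> supported_in U"
      using supported_in_mono[OF assms(2)] supported_in_uminus by blast
    \<comment> \<open>Inverses in a record are given by a definite description, so uniqueness is part of the claim.\<close>
    have "inv\<^bsub>add_monoid ?Q\<^esub> X = coset_mod V (- f)"
      unfolding m_inv_def f(1)
    proof (rule the_equality, goal_cases)
      case 1
      show ?case using fU by (simp add: carrier_quotient add_quotient zero_quotient)
    next
      case (2 Y)
      then obtain g where g: "Y = coset_mod V g" by (auto simp: carrier_quotient)
      then show ?case using 2 by (simp add: add_quotient zero_quotient coset_mod_eq_iff)
    qed
    then show ?thesis using f(2) supported_in_uminus by blast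
  qed
  show "smult ?Q r X \<in> ?N" if r: "r \<in> carrier (semigroup_ring T)" and X: "X \<in> ?N" for r X
  proof -
    obtain f where f: "X = coset_mod V f" "f \<in> supported_in W" using X by blast
    then have "r * f \<in> supported_in W"
      using r mult_supported_in[of r f W] assms(3) by simp
    then show ?thesis using f(1) r by (simp add: smult_quotient)
  qed
qed

text \<open>
Exponents from \<open>U - V\<close> are added to \<open>V\<close> one at a time, the largest first. Adding an element of \<open>T\<close> never
decreases an exponent, so every intermediate set of exponents absorbs \<open>T\<close> again and gives a submodule.
\<close>
lemma chain_of_length_card:
  "\<exists>N. (\<forall>i\<le>card (U - V). submodule (N i) (semigroup_ring T) (quotient :: ('k::field fps, _) module))
     \<and> (\<forall>i<card (U - V). N i \<subset> N (Suc i))"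
proof -
  let ?D = "U - V"
  define W where "W i = V \<union> {d \<in> ?D. card {x \<in> ?D. d < x} < i}" for i
  define N :: "nat \<Rightarrow> 'k fps set set" where "N i = coset_mod V ` supported_in (W i)" for i
  have absorb: "t + w \<in> W i" if "t \<in> T" "w \<in> W i" for t w i
  proof (cases "w \<in> V")
    case True then show ?thesis using V_absorb that by (simp add: W_def)
  next
    case False
    then have w: "w \<in> ?D" "card {x \<in> ?D. w < x} < i" using that by (auto simp: W_def)
    have "card {x \<in> ?D. t + w < x} \<le> card {x \<in> ?D. w < x}"
      by (intro card_mono) (auto intro: finite_subset[OF _ finite_diff])
    then have "card {x \<in> ?D. t + w < x} < i" using w(2) by linarith
    then show ?thesis using w(1) U_absorb[OF that(1), of w] by (simp add: W_def)
  qed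
  have "submodule (N i) (semigroup_ring T) quotient" for i
    unfolding N_def
  proof (rule submodule_supported_in)
    show "V \<subseteq> W i" "W i \<subseteq> U" using sub by (auto simp: W_def)
  qed (rule absorb)
  moreover have "N i \<subset> N (Suc i)" if i: "i < card ?D" for i
  proof -
    obtain d where d: "d \<in> ?D" "card {x \<in> ?D. d < x} = i"
      using ex_card_greater_eq[OF finite_diff i] by blast
    have "W i \<subseteq> W (Suc i)" by (auto simp: W_def)
    then have "N i \<subseteq> N (Suc i)" unfolding N_def by (intro image_mono supported_in_mono)
    moreover have "coset_mod V (fps_X ^ d) \<in> N (Suc i)"
      unfolding N_def using d by (intro imageI supported_in_X_power) (simp add: W_def)
    moreover have "coset_mod V (fps_X ^ d) \<notin> N i"
    proof
      assume "coset_mod V (fps_X ^ d) \<in> N i"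
      then obtain f :: "'k fps" where f: "f \<in> supported_in (W i)" "fps_X ^ d - f \<in> supported_in V"
        by (auto simp: N_def coset_mod_eq_iff)
      then have "fps_nth f d = 0" "fps_nth (fps_X ^ d - f) d = 0"
        using d by (auto simp: supported_in_def W_def)
      then show False by simp
    qed
    ultimately show ?thesis by blast
  qed
  ultimately show ?thesis by (intro exI[of _ N]) simp
qed

text \<open>
Submodules of the quotient lift to spaces of series which are closed under linear combinations, since
\<open>T\<close> contains \<open>0\<close> and the ring thus contains the constants. Along a strict chain the set of leading
exponents grows strictly, inside a set of \<open>card (U - V)\<close> elements.
\<close>
lemma chain_length_le_card:
  assumes sm: "\<And>i. i \<le> l \<Longrightarrow> submodule (N i) (semigroup_ring T) (quotient :: ('k::field fps, _) module)"
    and strict: "\<And>i. i < l \<Longrightarrow> N i \<subset> N (Suc i)"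
  shows "l \<le> card (U - V)"
proof -
  let ?D = "U - V"
  define L where "L i = {f \<in> supported_in U. coset_mod V f \<in> N i}" for i
  have lin: "f + fps_const c * g \<in> L i" if "i \<le> l" "f \<in> L i" "g \<in> L i" for f g c i
  proof -
    interpret submodule "N i" "semigroup_ring T" "quotient :: ('k fps, _) module"
      using sm that(1) by blast
    have c: "fps_const c \<in> carrier (semigroup_ring T)"
      using supported_in_const zero_in by simp
    have "smult quotient (fps_const c) (coset_mod V g) \<in> N i"
      using smult_closed[OF c] that by (simp add: L_def)
    then have "coset_mod V (fps_const c * g) \<in> N i" using c by (simp add: smult_quotient)
    then have "add quotient (coset_mod V f) (coset_mod V (fps_const c * g)) \<in> N i"
      using m_closed that by (simp add: L_def)
    then show ?thesis
      using that by (auto simp: L_def add_quotient intro: supported_in_add supported_in_const_mult)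
  qed
  have vanish: "f \<in> L i" if "i \<le> l" "f \<in> supported_in U" "\<forall>x\<in>?D. fps_nth f x = 0" for f i
  proof -
    have "f \<in> supported_in V" using that by (auto simp: supported_in_def)
    then have "coset_mod V f = \<one>\<^bsub>add_monoid quotient\<^esub>" by (simp add: zero_quotient coset_mod_eq_iff)
    moreover have "subgroup (N i) (add_monoid quotient)"
      using sm[OF that(1)] by (simp add: submodule_def)
    ultimately have "coset_mod V f \<in> N i" using subgroup.one_closed by metis
    then show ?thesis using that(2) by (simp add: L_def)
  qed
  have "leading_exponents ?D (L i) \<subset> leading_exponents ?D (L (Suc i))" if i: "i < l" for i
  proof -
    have sub_L: "L i \<subseteq> L (Suc i)" using strict[OF i] by (auto simp: L_def)
    obtain X where X: "X \<in> N (Suc i)" "X \<notin> N i" using strict[OF i] by blast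
    have "N (Suc i) \<subseteq> carrier (add_monoid quotient)"
      using sm[of "Suc i"] i by (intro subgroup.subset submodule.axioms(1)) simp
    then obtain f where "f \<in> supported_in U" "X = coset_mod V f" using X(1) by (auto simp: carrier_quotient)
    then have "\<not> L (Suc i) \<subseteq> L i" using X by (auto simp: L_def)
    moreover have "leading_exponents ?D (L i) \<subseteq> leading_exponents ?D (L (Suc i))"
      using sub_L by (auto simp: leading_exponents_def)
    moreover have "L (Suc i) \<subseteq> L i"
      if "leading_exponents ?D (L (Suc i)) \<subseteq> leading_exponents ?D (L i)"
    proof (rule subset_if_leading_exponents_subset[OF finite_diff _ _ sub_L _ that])
      show "f + fps_const c * g \<in> L i" if "f \<in> L i" "g \<in> L i" for f g c
        using lin[of i] that i by simp
      show "f + fps_const c * g \<in> L (Suc i)" if "f \<in> L (Suc i)" "g \<in> L (Suc i)" for f g c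
        using lin[of "Suc i"] that i by simp
      show "f \<in> L i" if "f \<in> L (Suc i)" "\<forall>x\<in>?D. fps_nth f x = 0" for f
        using vanish[of i f] that i by (simp add: L_def)
    qed
    ultimately show ?thesis by blast
  qed
  then have "i \<le> l \<Longrightarrow> i \<le> card (leading_exponents ?D (L i))" for i
  proof (induction i)
    case (Suc i)
    have "finite (leading_exponents ?D (L (Suc i)))"
      using finite_diff by (rule rev_finite_subset) (auto simp: leading_exponents_def)
    then have "card (leading_exponents ?D (L i)) < card (leading_exponents ?D (L (Suc i)))"
      using Suc.prems by (intro psubset_card_mono) auto
    then show ?case using Suc by simp
  qed simp
  then have "l \<le> card (leading_exponents ?D (L l))" by simp
  also have "\<dots> \<le> card ?D"
    using finite_diff by (intro card_mono) (auto simp: leading_exponents_def)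
  finally show ?thesis .
qed

lemma module_length_quotient:
  "module_length (semigroup_ring T) (quotient :: ('k::field fps, _) module) = enat (card (U - V))"
proof -
  let ?S = "{l. \<exists>N. (\<forall>i\<le>l. submodule (N i) (semigroup_ring T) (quotient :: ('k fps, _) module))
     \<and> (\<forall>i<l. N i \<subset> N (Suc i))}"
  have "card (U - V) \<in> ?S" using chain_of_length_card by simp
  moreover have "l \<le> card (U - V)" if l: "l \<in> ?S" for l
  proof -
    obtain N where "\<forall>i\<le>l. submodule (N i) (semigroup_ring T) (quotient :: ('k fps, _) module)"
      "\<forall>i<l. N i \<subset> N (Suc i)"
      using l by blast
    then show ?thesis by (intro chain_length_le_card[of l N]) auto
  qed
  ultimately show ?thesis
    unfolding module_length_def by (intro antisym SUP_least SUP_upper) simp_all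
qed

end

lemma (in fg_nat_submonoid) hilbert_function_eq:
  "hilbert_function (K :: 'k::field itself) T n = enat (card {s \<in> T. ord_sg T s = n})"
proof -
  interpret monomial_quotient T "nfold_max_part n T" "nfold_max_part (Suc n) T"
    using nfold_Suc_subset nfold_subset add_nfold finite_ord_eq
    by unfold_locales (auto simp: nfold_diff_eq_ord)
  show ?thesis
    using module_length_quotient[where 'k = 'k]
    by (simp add: hilbert_function_def tangent_cone_component_def max_ideal_power_eq nfold_diff_eq_ord)
qed

section \<open>Normal forms in a gluing\<close>

locale gluing =
  S1: nat_submonoid S\<^sub>1 + S2: fg_cofinite_nat_submonoid S\<^sub>2 B
  for S\<^sub>1 S\<^sub>2 B :: "nat set" +
  fixes p q :: nat
  assumes p: "p \<in> S\<^sub>1" "0 < p" and q: "q \<in> S\<^sub>2" "0 < q" and coprime: "coprime p q"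
begin

definition glued :: "nat set" where
  "glued = {q * a + p * b | a b. a \<in> S\<^sub>1 \<and> b \<in> S\<^sub>2}"

definition apery :: "nat set" where
  "apery = S\<^sub>2 - (+) q ` S\<^sub>2"

text \<open>
An element \<open>b \<ge> q\<close> of the Apery set is \<open>q\<close> plus a gap of \<open>S\<^sub>2\<close>.
\<close>
lemma finite_apery: "finite apery"
proof -
  have "apery \<subseteq> {..<q} \<union> (+) q ` (- S\<^sub>2)"
  proof
    fix b assume "b \<in> apery"
    then have "b \<notin> (+) q ` S\<^sub>2" by (simp add: apery_def)
    then have "q \<le> b \<Longrightarrow> b - q \<notin> S\<^sub>2" by (metis imageI le_add_diff_inverse)
    then show "b \<in> {..<q} \<union> (+) q ` (- S\<^sub>2)"
      by (cases "b < q") (auto intro!: image_eqI[of _ _ "b - q"])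
  qed
  then show ?thesis using S2.cofinite by (meson finite_UnI finite_imageI finite_lessThan finite_subset)
qed

lemma mult_q_in: "q * j \<in> S\<^sub>2"
  by (induction j) (simp_all add: S2.zero_in S2.add_in q)

lemma mult_p_in: "p * j \<in> S\<^sub>1"
  by (induction j) (simp_all add: S1.zero_in S1.add_in p)

lemma normal_form_ex:
  assumes "b \<in> S\<^sub>2"
  obtains j b' where "b' \<in> apery" "b = b' + q * j"
proof -
  have "\<exists>j b'. b' \<in> apery \<and> b = b' + q * j"
    using assms
  proof (induction b rule: less_induct)
    case (less b)
    show ?case
    proof (cases "b \<in> apery")
      case True then show ?thesis by (intro exI[of _ 0] exI[of _ b]) simp
    next
      case False
      then obtain c where c: "c \<in> S\<^sub>2" "b = q + c" using less.prems by (auto simp: apery_def)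
      then obtain j b' where "b' \<in> apery" "c = b' + q * j" using less.IH[of c] q by auto
      then show ?thesis using c by (intro exI[of _ "Suc j"] exI[of _ b']) simp
    qed
  qed
  then show thesis using that by blast
qed

text \<open>
Coprimality makes the second components congruent modulo \<open>q\<close>. An element of the Apery set cannot
exceed another element of \<open>S\<^sub>2\<close> in its residue class, so the difference has the stated sign.
\<close>
lemma representation:
  assumes "b \<in> apery" "b' \<in> S\<^sub>2" "q * a + p * b = q * a' + p * b'"
  obtains j where "b' = b + q * j" "a = a' + p * j"
proof (cases "b \<le> b'")
  case True
  then obtain c where c: "b' = b + c" using le_Suc_ex by blast
  then have eq: "q * a = q * a' + p * c" using assms(3) by (simp add: algebra_simps)
  then have "q dvd p * c" by (metis dvd_add_right_iff dvd_triv_left)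
  then have "q dvd c" using coprime by (simp add: coprime_dvd_mult_right_iff coprime_commute)
  then obtain j where j: "c = q * j" by blast
  have "q * a = q * (a' + p * j)" using eq j by (simp add: algebra_simps)
  then show thesis using that[of j] c j q by simp
next
  case False
  then obtain c where c: "b = b' + c" "0 < c" by (metis less_imp_add_positive not_le)
  then have eq: "q * a' = q * a + p * c" using assms(3) by (simp add: algebra_simps)
  then have "q dvd p * c" by (metis dvd_add_right_iff dvd_triv_left)
  then have "q dvd c" using coprime by (simp add: coprime_dvd_mult_right_iff coprime_commute)
  then obtain j where "c = q * j" by blast
  then obtain i where "c = q * Suc i" using c(2) by (cases j) auto
  then have "b = q + (b' + q * i)" using c by simp
  then show thesis using assms(1,2) S2.add_in[OF assms(2) mult_q_in] by (auto simp: apery_def)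
qed

sublocale S: nat_submonoid glued
proof
  show "0 \<in> glued" using S1.zero_in S2.zero_in by (force simp: glued_def)
  fix x y assume "x \<in> glued" "y \<in> glued"
  then obtain a b a' b' where "x = q * a + p * b" "y = q * a' + p * b'"
    "a \<in> S\<^sub>1" "b \<in> S\<^sub>2" "a' \<in> S\<^sub>1" "b' \<in> S\<^sub>2" by (auto simp: glued_def)
  then have "x + y = q * (a + a') + p * (b + b') \<and> a + a' \<in> S\<^sub>1 \<and> b + b' \<in> S\<^sub>2"
    using S1.add_in S2.add_in by (simp add: algebra_simps)
  then show "x + y \<in> glued" unfolding glued_def by blast
qed

lemma gluedI: "a \<in> S\<^sub>1 \<Longrightarrow> b \<in> S\<^sub>2 \<Longrightarrow> q * a + p * b \<in> glued"
  by (auto simp: glued_def)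

lemma gluedE:
  assumes "s \<in> glued"
  obtains a b where "a \<in> S\<^sub>1" "b \<in> S\<^sub>2" "s = q * a + p * b"
  using assms by (auto simp: glued_def)

lemma mult_q_glued: "a \<in> S\<^sub>1 \<Longrightarrow> q * a \<in> glued"
  using gluedI[OF _ S2.zero_in] by simp

lemma mult_p_glued: "b \<in> S\<^sub>2 \<Longrightarrow> p * b \<in> glued"
  using gluedI[OF S1.zero_in] by simp

lemma mult_q_nfold: "a \<in> nfold_max_part n S\<^sub>1 \<Longrightarrow> q * a \<in> nfold_max_part n glued"
proof (induction n arbitrary: a)
  case 0 then show ?case by (simp add: mult_q_glued)
next
  case (Suc n)
  obtain x y where xy: "a = x + y" "x \<in> max_part S\<^sub>1" "y \<in> nfold_max_part n S\<^sub>1"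
    using Suc.prems by (rule S1.nfold_SucE)
  then have "q * x \<in> glued" using mult_q_glued by (simp add: max_part_def)
  then have "q * x \<in> max_part glued" using xy(2) q by (simp add: max_part_def)
  then show ?case using S.nfold_SucI[OF _ Suc.IH[OF xy(3)]] xy(1) by (simp add: distrib_left)
qed

lemma mult_p_nfold: "b \<in> nfold_max_part n S\<^sub>2 \<Longrightarrow> p * b \<in> nfold_max_part n glued"
proof (induction n arbitrary: b)
  case 0 then show ?case by (simp add: mult_p_glued)
next
  case (Suc n)
  obtain x y where xy: "b = x + y" "x \<in> max_part S\<^sub>2" "y \<in> nfold_max_part n S\<^sub>2"
    using Suc.prems by (rule S2.nfold_SucE)
  then have "p * x \<in> glued" using mult_p_glued by (simp add: max_part_def)
  then have "p * x \<in> max_part glued" using xy(2) p by (simp add: max_part_def)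
  then show ?case using S.nfold_SucI[OF _ Suc.IH[OF xy(3)]] xy(1) by (simp add: distrib_left)
qed

text \<open>
Each of \<open>n\<close> nonzero summands \<open>q c + p d\<close> contributes at least one to the order of the first or of the
second component.
\<close>
lemma nfold_glued_representation:
  "s \<in> nfold_max_part n glued \<Longrightarrow>
    \<exists>a\<in>S\<^sub>1. \<exists>b\<in>S\<^sub>2. s = q * a + p * b \<and> n \<le> ord_sg S\<^sub>1 a + ord_sg S\<^sub>2 b"
proof (induction n arbitrary: s)
  case 0 then show ?case by (auto elim!: gluedE)
next
  case (Suc n)
  obtain x y where xy: "s = x + y" "x \<in> max_part glued" "y \<in> nfold_max_part n glued"
    using Suc.prems by (rule S.nfold_SucE)
  obtain a b where y: "y = q * a + p * b" "a \<in> S\<^sub>1" "b \<in> S\<^sub>2" "n \<le> ord_sg S\<^sub>1 a + ord_sg S\<^sub>2 b"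
    using Suc.IH[OF xy(3)] by blast
  obtain c d where x: "x = q * c + p * d" "c \<in> S\<^sub>1" "d \<in> S\<^sub>2" "x \<noteq> 0"
    using xy(2) by (auto simp: max_part_def elim!: gluedE)
  then have "c \<in> max_part S\<^sub>1 \<or> d \<in> max_part S\<^sub>2" by (auto simp: max_part_def)
  then have "0 < ord_sg S\<^sub>1 c + ord_sg S\<^sub>2 d" using S1.ord_pos[of c] S2.ord_pos[of d] by linarith
  then have "Suc n \<le> ord_sg S\<^sub>1 (c + a) + ord_sg S\<^sub>2 (d + b)"
    using S1.ord_superadditive[OF x(2) y(2)] S2.ord_superadditive[OF x(3) y(3)] y(4) by linarith
  moreover have "s = q * (c + a) + p * (d + b)" using xy x y by (simp add: algebra_simps)
  ultimately show ?case using S1.add_in[OF x(2) y(2)] S2.add_in[OF x(3) y(3)] by blast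
qed

lemma generated_eq_glued:
  assumes "S\<^sub>1 = generated_semigroup A" "S\<^sub>2 = generated_semigroup C"
  shows "generated_semigroup ((\<lambda>a. q * a) ` A \<union> (\<lambda>b. p * b) ` C) = glued" (is "?G = _")
proof (intro equalityI subsetI)
  fix s assume "s \<in> ?G"
  then show "s \<in> glued"
  proof induction
    case zero show ?case by (rule S.zero_in)
  next
    case (add x s)
    have "a \<in> S\<^sub>1" if "a \<in> A" for a
      using generated_semigroup.add[OF that generated_semigroup.zero] assms by simp
    moreover have "b \<in> S\<^sub>2" if "b \<in> C" for b
      using generated_semigroup.add[OF that generated_semigroup.zero] assms by simp
    ultimately have "x \<in> glued"
      using add.hyps(1) mult_q_glued mult_p_glued by auto
    then show ?case using add.IH S.add_in by blast
  qed
next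
  interpret G: nat_submonoid ?G by (rule nat_submonoid_generated)
  fix s assume "s \<in> glued"
  then obtain a b where s: "s = q * a + p * b" "a \<in> generated_semigroup A" "b \<in> generated_semigroup C"
    unfolding assms[symmetric] by (rule gluedE)
  have "q * a \<in> ?G" using s(2)
    by induction (auto simp: algebra_simps intro: generated_semigroup.intros)
  moreover have "p * b \<in> ?G" using s(3)
    by induction (auto simp: algebra_simps intro: generated_semigroup.intros)
  ultimately show "s \<in> ?G" using s(1) G.add_in by simp
qed

end

section \<open>Orders and Hilbert function of a specific gluing\<close>

locale specific_gluing = gluing +
  assumes specific: "int (ord_sg S\<^sub>2 q) + l_sg q S\<^sub>2 \<le> int (ord_sg S\<^sub>1 p)"
begin

text \<open>
The hypothesis of a specific gluing, iterated: each added \<open>q\<close> raises the order by at most that of \<open>p\<close>.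
\<close>
lemma ord_add_mult_q_le:
  "b \<in> S\<^sub>2 \<Longrightarrow> ord_sg S\<^sub>2 (b + q * j) \<le> ord_sg S\<^sub>2 b + j * ord_sg S\<^sub>1 p"
proof (induction j)
  case (Suc j)
  have "int (ord_sg S\<^sub>2 (b + q * j + q)) \<le> int (ord_sg S\<^sub>2 (b + q * j)) + int (ord_sg S\<^sub>1 p)"
    using S2.ord_add_le[OF q(1) S2.add_in[OF Suc.prems mult_q_in], of j] specific by linarith
  then have "ord_sg S\<^sub>2 (b + q * j + q) \<le> ord_sg S\<^sub>2 (b + q * j) + ord_sg S\<^sub>1 p" by linarith
  also have "\<dots> \<le> ord_sg S\<^sub>2 b + Suc j * ord_sg S\<^sub>1 p" using Suc.IH[OF Suc.prems] by simp
  finally show ?case by (simp add: ac_simps)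
qed simp

lemma ord_mult_p_ge: "j * ord_sg S\<^sub>1 p \<le> ord_sg S\<^sub>1 (p * j)"
proof (induction j)
  case (Suc j)
  then show ?case using S1.ord_superadditive[OF p(1) mult_p_in[of j]] by simp
qed simp

text \<open>
Among all representations, the one with second component in the Apery set has the largest sum of
orders, because moving \<open>p j\<close> to the first component gains at least what the second component loses.
\<close>
lemma ord_glued:
  assumes "a \<in> S\<^sub>1" "b \<in> apery"
  shows "ord_sg glued (q * a + p * b) = ord_sg S\<^sub>1 a + ord_sg S\<^sub>2 b"
proof (rule antisym)
  have b: "b \<in> S\<^sub>2" using assms(2) by (simp add: apery_def)
  let ?s = "q * a + p * b"
  have s: "?s \<in> glued" using assms(1) b by (rule gluedI)
  have "?s \<in> nfold_max_part (ord_sg S\<^sub>1 a + ord_sg S\<^sub>2 b) glued"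
    using S.nfold_add[OF mult_q_nfold mult_p_nfold, OF S1.nfold_ordI S2.nfold_ordI] assms(1) b by blast
  then show "ord_sg S\<^sub>1 a + ord_sg S\<^sub>2 b \<le> ord_sg glued ?s" using S.nfold_iff_le_ord[OF s] by simp
  obtain a' b' where ab: "a' \<in> S\<^sub>1" "b' \<in> S\<^sub>2" "?s = q * a' + p * b'"
    "ord_sg glued ?s \<le> ord_sg S\<^sub>1 a' + ord_sg S\<^sub>2 b'"
    using nfold_glued_representation[OF S.nfold_ordI[OF s]] by blast
  obtain j where j: "b' = b + q * j" "a = a' + p * j"
    using assms(2) ab(2,3) by (rule representation)
  have "ord_sg S\<^sub>1 a' + j * ord_sg S\<^sub>1 p \<le> ord_sg S\<^sub>1 a"
    using S1.ord_superadditive[OF ab(1) mult_p_in[of j]] ord_mult_p_ge[of j] j(2) by simp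
  then show "ord_sg glued ?s \<le> ord_sg S\<^sub>1 a + ord_sg S\<^sub>2 b"
    using ord_add_mult_q_le[OF b, of j] j(1) ab(4) by simp
qed

text \<open>
Counts the elements of order \<open>n\<close> by normal forms: the second component \<open>b\<close> lies in the Apery set and
takes up \<open>ord b\<close> of the order, which leaves \<open>n - ord b\<close> for the first component. Truncated subtraction
does no harm, as the sum is restricted to \<open>ord b \<le> n\<close>.
\<close>
lemma card_ord_glued:
  assumes fin: "\<And>k. finite {a \<in> S\<^sub>1. ord_sg S\<^sub>1 a = k}"
  shows "card {s \<in> glued. ord_sg glued s = n}
    = (\<Sum>b | b \<in> apery \<and> ord_sg S\<^sub>2 b \<le> n. card {a \<in> S\<^sub>1. ord_sg S\<^sub>1 a = n - ord_sg S\<^sub>2 b})"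
proof -
  let ?I = "{b. b \<in> apery \<and> ord_sg S\<^sub>2 b \<le> n}"
  let ?F = "\<lambda>b. {a \<in> S\<^sub>1. ord_sg S\<^sub>1 a = n - ord_sg S\<^sub>2 b}"
  have "bij_betw (\<lambda>(b, a). q * a + p * b) (Sigma ?I ?F) {s \<in> glued. ord_sg glued s = n}"
    unfolding bij_betw_def
  proof (intro conjI inj_onI equalityI subsetI)
    fix x y assume xy: "x \<in> Sigma ?I ?F" "y \<in> Sigma ?I ?F"
      "(case x of (b, a) \<Rightarrow> q * a + p * b) = (case y of (b, a) \<Rightarrow> q * a + p * b)"
    obtain b a where x: "x = (b, a)" by (cases x)
    obtain d c where y: "y = (d, c)" by (cases y)
    have bd: "b \<in> apery" "d \<in> apery" "b \<in> S\<^sub>2" "d \<in> S\<^sub>2" and eq: "q * a + p * b = q * c + p * d"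
      using xy x y by (auto simp: apery_def)
    obtain i where i: "d = b + q * i" "a = c + p * i" using bd(1,4) eq by (rule representation)
    obtain j where j: "b = d + q * j" "c = a + p * j" using bd(2,3) eq[symmetric] by (rule representation)
    show "x = y" using i j x y by simp
  next
    fix s assume "s \<in> (\<lambda>(b, a). q * a + p * b) ` Sigma ?I ?F"
    then obtain a b where "s = q * a + p * b" "b \<in> ?I" "a \<in> ?F b" by auto
    then show "s \<in> {s \<in> glued. ord_sg glued s = n}"
      using ord_glued[of a b] gluedI[of a b] by (simp add: apery_def)
  next
    fix s assume s: "s \<in> {s \<in> glued. ord_sg glued s = n}"
    then obtain a b where ab: "a \<in> S\<^sub>1" "b \<in> S\<^sub>2" "s = q * a + p * b" by (auto elim!: gluedE)
    obtain j b' where j: "b' \<in> apery" "b = b' + q * j" using ab(2) by (rule normal_form_ex)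
    have a': "a + p * j \<in> S\<^sub>1" using S1.add_in[OF ab(1) mult_p_in] .
    have s': "s = q * (a + p * j) + p * b'" using ab(3) j(2) by (simp add: algebra_simps)
    then have "n = ord_sg S\<^sub>1 (a + p * j) + ord_sg S\<^sub>2 b'" using ord_glued[OF a' j(1)] s by simp
    then have "(b', a + p * j) \<in> Sigma ?I ?F" using a' j(1) by simp
    then show "s \<in> (\<lambda>(b, a). q * a + p * b) ` Sigma ?I ?F" using s' by (force intro: rev_image_eqI)
  qed
  then have "card {s \<in> glued. ord_sg glued s = n} = card (Sigma ?I ?F)"
    by (rule bij_betw_same_card[symmetric])
  also have "\<dots> = (\<Sum>b\<in>?I. card (?F b))" using finite_apery fin by (intro card_SigmaI) auto
  finally show ?thesis .
qed

lemma card_ord_glued_mono: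
  assumes fin: "\<And>k. finite {a \<in> S\<^sub>1. ord_sg S\<^sub>1 a = k}"
    and mono: "\<And>k. card {a \<in> S\<^sub>1. ord_sg S\<^sub>1 a = k} \<le> card {a \<in> S\<^sub>1. ord_sg S\<^sub>1 a = Suc k}"
  shows "card {s \<in> glued. ord_sg glued s = n} \<le> card {s \<in> glued. ord_sg glued s = Suc n}"
proof -
  let ?H = "\<lambda>k. card {a \<in> S\<^sub>1. ord_sg S\<^sub>1 a = k}"
  have "(\<Sum>b | b \<in> apery \<and> ord_sg S\<^sub>2 b \<le> n. ?H (n - ord_sg S\<^sub>2 b))
    \<le> (\<Sum>b | b \<in> apery \<and> ord_sg S\<^sub>2 b \<le> n. ?H (Suc n - ord_sg S\<^sub>2 b))"
    using mono by (intro sum_mono) (simp add: Suc_diff_le)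
  also have "\<dots> \<le> (\<Sum>b | b \<in> apery \<and> ord_sg S\<^sub>2 b \<le> Suc n. ?H (Suc n - ord_sg S\<^sub>2 b))"
    using finite_apery by (intro sum_mono2) auto
  finally show ?thesis by (simp add: card_ord_glued[OF fin])
qed

end

theorem theorem4p1:
  fixes K :: "'k::field itself"
    and S\<^sub>1 S\<^sub>2 S :: "nat set"
    and m n :: "nat \<Rightarrow> nat"
    and d k p q :: nat
  assumes "numerical_semigroup S\<^sub>1"
    and "numerical_semigroup S\<^sub>2"
    and "strict_mono_on {1..d} m"
    and "strict_mono_on {1..k} n"
    and "minimally_generates (m ` {1..d}) S\<^sub>1"
    and "minimally_generates (n ` {1..k}) S\<^sub>2"
    and "is_specific_gluing S\<^sub>1 (m ` {1..d}) S\<^sub>2 (n ` {1..k}) p q S"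
    and "nondecreasing_hilbert_function K S\<^sub>1"
  shows "nondecreasing_hilbert_function K S"
proof -
  let ?A = "m ` {1..d}" and ?B = "n ` {1..k}"
  have gen: "S\<^sub>1 = generated_semigroup ?A" "S\<^sub>2 = generated_semigroup ?B"
    using assms(5,6) by (simp_all add: minimally_generates_def)
  interpret S1: fg_nat_submonoid S\<^sub>1 ?A
    unfolding gen(1) by (rule fg_nat_submonoid_generated) simp
  interpret S2: fg_nat_submonoid S\<^sub>2 ?B
    unfolding gen(2) by (rule fg_nat_submonoid_generated) simp
  interpret specific_gluing S\<^sub>1 S\<^sub>2 ?B p q
    using assms(2,7)
    by unfold_locales (auto simp: is_specific_gluing_def is_gluing_def numerical_semigroup_def coprime_iff_gcd_eq_1)
  let ?C = "(\<lambda>a. q * a) ` ?A \<union> (\<lambda>b. p * b) ` ?B"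
  have S: "S = generated_semigroup ?C" "S = glued"
    using assms(7) generated_eq_glued[OF gen] by (simp_all add: is_specific_gluing_def is_gluing_def)
  interpret SC: fg_nat_submonoid S ?C
    unfolding S(1) by (rule fg_nat_submonoid_generated) simp
  have "card {a \<in> S\<^sub>1. ord_sg S\<^sub>1 a = i} \<le> card {a \<in> S\<^sub>1. ord_sg S\<^sub>1 a = Suc i}" for i
    using assms(8) by (simp add: nondecreasing_hilbert_function_def S1.hilbert_function_eq)
  then have "card {s \<in> S. ord_sg S s = i} \<le> card {s \<in> S. ord_sg S s = Suc i}" for i
    unfolding S(2) using card_ord_glued_mono S1.finite_ord_eq by blast
  then show ?thesis by (simp add: nondecreasing_hilbert_function_def SC.hilbert_function_eq)
qed

end
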